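(* Let $\mathcal{P}=(P,\{\,,\,\})$, $P=P_0\ltimes P_1$, be an admissible Poisson algebra with corresponding Poisson triple $([\,,\,]_1,\mathcal{D},\mathcal{K})$. An element $k\oplus\zeta\in P$ is a Casimir element of $\mathcal{P}$ if and only if $$k\oplus\zeta\in\big(\mathrm{Casim}(\mathcal{P}_0)\oplus P_1\big)\cap\ker\mathscr{T}\quad\text{and}\quad\mathcal{D}_{dk}+[\zeta,\cdot]_1=0.$$
   Context: Let $R$ be a commutative ring with unit, $\mathcal{P}_0=(P_0,\cdot,\{\,,\,\}_0)$ a Poisson $R$-algebra (commutative associative unital $R$-algebra with an $R$-bilinear Lie bracket that is a derivation in each argument), $P_1$ a faithful $P_0$-module, and $P=P_0\ltimes P_1$ the $R$-module $P_0\oplus P_1$ with product $(f\oplus\eta)(g\oplus\xi)=fg\oplus(f\xi+g\eta)$. An admissible Poisson structure on $P$ is a Poisson structure with $\mathrm{pr}_0\{f\oplus\eta,g\oplus\xi\}=\{f,g\}_0$; $(P,\{\,,\,\})$ is then an admissible Poisson algebra. $\Omega^1_{P_0}$ is the module of Kähler differentials of $P_0$ over $R$ with universal derivation $d$, anchor $\varrho_{P_0}(dh)=\{h,\cdot\}_0$ (extended $P_0$-linearly). A contravariant derivative on $P_1$ is an $R$-bilinear map $\mathcal{D}:\Omega^1_{P_0}\times P_1\to P_1$ with $\mathcal{D}_{f\alpha}\eta=f\mathcal{D}_\alpha\eta$, $\mathcal{D}_\alpha(f\eta)=f\mathcal{D}_\alpha\eta+\varrho_{P_0}(\alpha)(f)\eta$.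 Every admissible Poisson algebra has a unique corresponding Poisson triple $([\,,\,]_1,\mathcal{D},\mathcal{K})$, where $[\,,\,]_1$ is a $P_0$-linear Lie bracket on $P_1$, $\mathcal{D}$ a contravariant derivative on $P_1$, and $\mathcal{K}:\Omega^1_{P_0}\times\Omega^1_{P_0}\to P_1$ a $P_0$-bilinear skew-symmetric map, such that $\{f\oplus\eta,g\oplus\xi\}=\{f,g\}_0\oplus(\mathcal{D}_{df}\xi-\mathcal{D}_{dg}\eta+[\eta,\xi]_1+\mathcal{K}(df,dg))$. A Casimir element of a Poisson algebra is an element $k$ with $\{k,a\}=0$ for all $a$; $\mathrm{Casim}(\mathcal{P}_0)$ is the set of those of $\mathcal{P}_0$. For $f\oplus\eta\in P$, $\mathscr{T}_{f\oplus\eta}:P_0\to P_1$ is the derivation $\mathscr{T}_{f\oplus\eta}(g)=\mathcal{K}(df,dg)-\mathcal{D}_{dg}\eta$, and $\ker\mathscr{T}=\{f\oplus\eta\in P\mid\mathscr{T}_{f\oplus\eta}=0\}$. *)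

theory Defs
  imports "HOL-Algebra.Module" "HOL-Algebra.AbelCoset"
begin

section \<open>Modules over a commutative ring\<close>

text \<open>
  In a record of type \<^typ>\<open>('a, 'b) module\<close> that is only used as a module the fields
  \<^const>\<open>mult\<close> and \<^const>\<open>one\<close> carry no meaning; they are left undefined below.
\<close>

definition bilinear_over ::
  "('a, 'r) ring_scheme \<Rightarrow> ('a, 'b, 'm) module_scheme \<Rightarrow> ('a, 'c, 'n) module_scheme
    \<Rightarrow> ('a, 'd, 'q) module_scheme \<Rightarrow> ('b \<Rightarrow> 'c \<Rightarrow> 'd) \<Rightarrow> bool" where
  "bilinear_over R M N Q B \<longleftrightarrow>
    (\<forall>x\<in>carrier M. \<forall>y\<in>carrier N. B x y \<in> carrier Q) \<and>
    (\<forall>x\<in>carrier M. \<forall>x'\<in>carrier M. \<forall>y\<in>carrier N. B (x \<oplus>\<^bsub>M\<^esub> x') y = B x y \<oplus>\<^bsub>Q\<^esub> B x' y) \<and>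
    (\<forall>x\<in>carrier M. \<forall>y\<in>carrier N. \<forall>y'\<in>carrier N. B x (y \<oplus>\<^bsub>N\<^esub> y') = B x y \<oplus>\<^bsub>Q\<^esub> B x y') \<and>
    (\<forall>r\<in>carrier R. \<forall>x\<in>carrier M. \<forall>y\<in>carrier N. B (r \<odot>\<^bsub>M\<^esub> x) y = r \<odot>\<^bsub>Q\<^esub> B x y) \<and>
    (\<forall>r\<in>carrier R. \<forall>x\<in>carrier M. \<forall>y\<in>carrier N. B x (r \<odot>\<^bsub>N\<^esub> y) = r \<odot>\<^bsub>Q\<^esub> B x y)"

definition linear_over ::
  "('a, 'r) ring_scheme \<Rightarrow> ('a, 'b, 'm) module_scheme \<Rightarrow> ('a, 'c, 'n) module_scheme
    \<Rightarrow> ('b \<Rightarrow> 'c) \<Rightarrow> bool" where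
  "linear_over R M N L \<longleftrightarrow>
    (\<forall>x\<in>carrier M. L x \<in> carrier N) \<and>
    (\<forall>x\<in>carrier M. \<forall>y\<in>carrier M. L (x \<oplus>\<^bsub>M\<^esub> y) = L x \<oplus>\<^bsub>N\<^esub> L y) \<and>
    (\<forall>r\<in>carrier R. \<forall>x\<in>carrier M. L (r \<odot>\<^bsub>M\<^esub> x) = r \<odot>\<^bsub>N\<^esub> L x)"

definition faithful_module :: "('a, 'r) ring_scheme \<Rightarrow> ('a, 'b, 'm) module_scheme \<Rightarrow> bool" where
  "faithful_module A M \<longleftrightarrow>
    (\<forall>f\<in>carrier A. (\<forall>x\<in>carrier M. f \<odot>\<^bsub>M\<^esub> x = \<zero>\<^bsub>M\<^esub>) \<longrightarrow> f = \<zero>\<^bsub>A\<^esub>)"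

text \<open>An \<open>A\<close>-module viewed as a module over \<open>R\<close>, where \<open>A\<close> is an \<open>R\<close>-algebra:
  \<open>r\<close> acts as \<open>r\<cdot>1 \<in> A\<close>.\<close>

definition restrict_scalars ::
  "('r, 'a, 'x) module_scheme \<Rightarrow> ('a, 'b, 'm) module_scheme \<Rightarrow> ('r, 'b) module" where
  "restrict_scalars A M =
    \<lparr>carrier = carrier M, mult = undefined, one = undefined, zero = zero M, add = add M,
     smult = (\<lambda>r x. (r \<odot>\<^bsub>A\<^esub> \<one>\<^bsub>A\<^esub>) \<odot>\<^bsub>M\<^esub> x)\<rparr>"

definition regular_module :: "('a, 'r) ring_scheme \<Rightarrow> ('a, 'a) module" where
  "regular_module A =
    \<lparr>carrier = carrier A, mult = mult A, one = one A, zero = zero A, add = add A, smult = mult A\<rparr>"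

definition submodule_span ::
  "('a, 'r) ring_scheme \<Rightarrow> ('a, 'b, 'm) module_scheme \<Rightarrow> 'b set \<Rightarrow> 'b set" where
  "submodule_span A M S = \<Inter>{H. submodule H A M \<and> S \<subseteq> H}"

definition quotient_module ::
  "('a, 'b, 'm) module_scheme \<Rightarrow> 'b set \<Rightarrow> ('a, 'b set) module" where
  "quotient_module M N =
    \<lparr>carrier = a_rcosets\<^bsub>M\<^esub> N, mult = undefined, one = undefined, zero = N, add = set_add M,
     smult = (\<lambda>a X. \<Union>x\<in>X. N +>\<^bsub>M\<^esub> (a \<odot>\<^bsub>M\<^esub> x))\<rparr>"

text \<open>The free \<open>A\<close>-module on a set \<open>B\<close>: finitely supported coefficient functions.\<close>

definition free_module :: "('a, 'r) ring_scheme \<Rightarrow> 'b set \<Rightarrow> ('a, 'b \<Rightarrow> 'a) module" where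
  "free_module A B =
    \<lparr>carrier = {c. (\<forall>b. c b \<in> carrier A) \<and> (\<forall>b. b \<notin> B \<longrightarrow> c b = \<zero>\<^bsub>A\<^esub>) \<and> finite {b. c b \<noteq> \<zero>\<^bsub>A\<^esub>}},
     mult = undefined, one = undefined, zero = (\<lambda>b. \<zero>\<^bsub>A\<^esub>), add = (\<lambda>c c' b. c b \<oplus>\<^bsub>A\<^esub> c' b),
     smult = (\<lambda>a c b. a \<otimes>\<^bsub>A\<^esub> c b)\<rparr>"

definition free_gen :: "('a, 'r) ring_scheme \<Rightarrow> 'b \<Rightarrow> 'b \<Rightarrow> 'a" where
  "free_gen A b = (\<lambda>b'. if b' = b then \<one>\<^bsub>A\<^esub> else \<zero>\<^bsub>A\<^esub>)"

text \<open>The linear map out of the free module that takes the value \<open>D b\<close> on the generator \<open>b\<close>.\<close>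

definition free_lift ::
  "('a, 'r) ring_scheme \<Rightarrow> ('a, 'c, 'm) module_scheme \<Rightarrow> ('b \<Rightarrow> 'c) \<Rightarrow> ('b \<Rightarrow> 'a) \<Rightarrow> 'c" where
  "free_lift A M D c = (\<Oplus>\<^bsub>M\<^esub>b\<in>{b. c b \<noteq> \<zero>\<^bsub>A\<^esub>}. c b \<odot>\<^bsub>M\<^esub> D b)"


section \<open>Kaehler differentials\<close>

definition derivation ::
  "('r, 'k) ring_scheme \<Rightarrow> ('r, 'a, 'x) module_scheme \<Rightarrow> ('a, 'b, 'm) module_scheme
    \<Rightarrow> ('a \<Rightarrow> 'b) \<Rightarrow> bool" where
  "derivation R A M D \<longleftrightarrow>
    linear_over R A (restrict_scalars A M) D \<and>
    (\<forall>f\<in>carrier A. \<forall>g\<in>carrier A. D (f \<otimes>\<^bsub>A\<^esub> g) = f \<odot>\<^bsub>M\<^esub> D g \<oplus>\<^bsub>M\<^esub> g \<odot>\<^bsub>M\<^esub> D f)"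

text \<open>
  \<open>kaehler R A\<close> is the free \<open>A\<close>-module on symbols \<open>df\<close> (\<open>f \<in> A\<close>) modulo
  \<open>d(f + g) = df + dg\<close>, \<open>d(r f) = r df\<close> for \<open>r \<in> R\<close>, and \<open>d(f g) = f dg + g df\<close>.
  The lemmas \<open>module_kaehler\<close>, \<open>derivation_kaehler_d\<close> and \<open>kaehler_universal\<close> below confirm that it
  carries the universal \<open>R\<close>-linear derivation of \<open>A\<close>.
\<close>

definition kaehler_free :: "('r, 'a, 'x) module_scheme \<Rightarrow> ('a, 'a \<Rightarrow> 'a) module" where
  "kaehler_free A = free_module A (carrier A)"

definition kaehler_relations ::
  "('r, 'k) ring_scheme \<Rightarrow> ('r, 'a, 'x) module_scheme \<Rightarrow> ('a \<Rightarrow> 'a) set" where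
  "kaehler_relations R A =
    (let F = kaehler_free A; e = free_gen A in
      {e (f \<oplus>\<^bsub>A\<^esub> g) \<ominus>\<^bsub>F\<^esub> (e f \<oplus>\<^bsub>F\<^esub> e g) | f g. f \<in> carrier A \<and> g \<in> carrier A} \<union>
      {e (r \<odot>\<^bsub>A\<^esub> f) \<ominus>\<^bsub>F\<^esub> (r \<odot>\<^bsub>A\<^esub> \<one>\<^bsub>A\<^esub>) \<odot>\<^bsub>F\<^esub> e f | r f. r \<in> carrier R \<and> f \<in> carrier A} \<union>
      {e (f \<otimes>\<^bsub>A\<^esub> g) \<ominus>\<^bsub>F\<^esub> (f \<odot>\<^bsub>F\<^esub> e g \<oplus>\<^bsub>F\<^esub> g \<odot>\<^bsub>F\<^esub> e f) | f g. f \<in> carrier A \<and> g \<in> carrier A})"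

definition kaehler_submodule ::
  "('r, 'k) ring_scheme \<Rightarrow> ('r, 'a, 'x) module_scheme \<Rightarrow> ('a \<Rightarrow> 'a) set" where
  "kaehler_submodule R A = submodule_span A (kaehler_free A) (kaehler_relations R A)"

definition kaehler ::
  "('r, 'k) ring_scheme \<Rightarrow> ('r, 'a, 'x) module_scheme \<Rightarrow> ('a, ('a \<Rightarrow> 'a) set) module" where
  "kaehler R A = quotient_module (kaehler_free A) (kaehler_submodule R A)"

definition kaehler_d ::
  "('r, 'k) ring_scheme \<Rightarrow> ('r, 'a, 'x) module_scheme \<Rightarrow> 'a \<Rightarrow> ('a \<Rightarrow> 'a) set" where
  "kaehler_d R A f = kaehler_submodule R A +>\<^bsub>kaehler_free A\<^esub> free_gen A f"

text \<open>The \<open>A\<close>-linear map on differentials with \<open>df \<mapsto> D f\<close>; its value on a coset is the common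
  value of \<^const>\<open>free_lift\<close> on all representatives, which exists when \<open>D\<close> is a derivation
  (\<open>kaehler_universal\<close>).\<close>

definition kaehler_lift ::
  "('r, 'a, 'x) module_scheme \<Rightarrow> ('a, 'b, 'm) module_scheme \<Rightarrow> ('a \<Rightarrow> 'b) \<Rightarrow> ('a \<Rightarrow> 'a) set \<Rightarrow> 'b" where
  "kaehler_lift A M D \<alpha> = (THE m. \<forall>c\<in>\<alpha>. free_lift A M D c = m)"


section \<open>Poisson algebras\<close>

locale lie_algebra = module R L for R (structure) and L (structure) +
  fixes bracket :: "'b \<Rightarrow> 'b \<Rightarrow> 'b"
  assumes bracket_bilinear: "bilinear_over R L L L bracket"
    and bracket_alternating: "x \<in> carrier L \<Longrightarrow> bracket x x = \<zero>\<^bsub>L\<^esub>"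
    and jacobi:
      "\<lbrakk>x \<in> carrier L; y \<in> carrier L; z \<in> carrier L\<rbrakk> \<Longrightarrow>
        bracket x (bracket y z) \<oplus>\<^bsub>L\<^esub> bracket y (bracket z x) \<oplus>\<^bsub>L\<^esub> bracket z (bracket x y) = \<zero>\<^bsub>L\<^esub>"

locale poisson_algebra = algebra R A + lie_algebra R A bracket
  for R (structure) and A (structure) and bracket +
  assumes leibniz_right:
      "\<lbrakk>f \<in> carrier A; g \<in> carrier A; h \<in> carrier A\<rbrakk> \<Longrightarrow>
        bracket f (g \<otimes>\<^bsub>A\<^esub> h) = g \<otimes>\<^bsub>A\<^esub> bracket f h \<oplus>\<^bsub>A\<^esub> h \<otimes>\<^bsub>A\<^esub> bracket f g"
    and leibniz_left:
      "\<lbrakk>f \<in> carrier A; g \<in> carrier A; h \<in> carrier A\<rbrakk> \<Longrightarrow>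
        bracket (f \<otimes>\<^bsub>A\<^esub> g) h = f \<otimes>\<^bsub>A\<^esub> bracket g h \<oplus>\<^bsub>A\<^esub> g \<otimes>\<^bsub>A\<^esub> bracket f h"

definition casimirs :: "('r, 'a, 'x) module_scheme \<Rightarrow> ('a \<Rightarrow> 'a \<Rightarrow> 'a) \<Rightarrow> 'a set" where
  "casimirs A bracket = {k \<in> carrier A. \<forall>a\<in>carrier A. bracket k a = \<zero>\<^bsub>A\<^esub>}"

definition anchor ::
  "('r, 'a, 'x) module_scheme \<Rightarrow> ('a \<Rightarrow> 'a \<Rightarrow> 'a) \<Rightarrow> ('a \<Rightarrow> 'a) set \<Rightarrow> 'a \<Rightarrow> 'a" where
  "anchor A bracket \<alpha> f = kaehler_lift A (regular_module A) (\<lambda>h. bracket h f) \<alpha>"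


section \<open>Admissible Poisson structures and Poisson triples\<close>

definition trivial_extension ::
  "('r, 'a, 'x) module_scheme \<Rightarrow> ('a, 'b, 'm) module_scheme \<Rightarrow> ('r, 'a \<times> 'b) module" where
  "trivial_extension P0 P1 =
    \<lparr>carrier = carrier P0 \<times> carrier P1,
     mult = (\<lambda>(f, \<eta>) (g, \<xi>). (f \<otimes>\<^bsub>P0\<^esub> g, f \<odot>\<^bsub>P1\<^esub> \<xi> \<oplus>\<^bsub>P1\<^esub> g \<odot>\<^bsub>P1\<^esub> \<eta>)),
     one = (\<one>\<^bsub>P0\<^esub>, \<zero>\<^bsub>P1\<^esub>),
     zero = (\<zero>\<^bsub>P0\<^esub>, \<zero>\<^bsub>P1\<^esub>),
     add = (\<lambda>(f, \<eta>) (g, \<xi>). (f \<oplus>\<^bsub>P0\<^esub> g, \<eta> \<oplus>\<^bsub>P1\<^esub> \<xi>)),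
     smult = (\<lambda>r (f, \<eta>). (r \<odot>\<^bsub>P0\<^esub> f, (r \<odot>\<^bsub>P0\<^esub> \<one>\<^bsub>P0\<^esub>) \<odot>\<^bsub>P1\<^esub> \<eta>))\<rparr>"

locale admissible_poisson_algebra =
  P0: poisson_algebra R P0 bracket0 + P1: module P0 P1 + P: poisson_algebra R "trivial_extension P0 P1" bracket
  for R (structure) and P0 and bracket0 and P1 and bracket +
  assumes faithful: "faithful_module P0 P1"
    and admissible:
      "\<lbrakk>x \<in> carrier (trivial_extension P0 P1); y \<in> carrier (trivial_extension P0 P1)\<rbrakk> \<Longrightarrow>
        fst (bracket x y) = bracket0 (fst x) (fst y)"

definition contravariant_derivative ::
  "('r, 'k) ring_scheme \<Rightarrow> ('r, 'a, 'x) module_scheme \<Rightarrow> ('a \<Rightarrow> 'a \<Rightarrow> 'a)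
    \<Rightarrow> ('a, 'b, 'm) module_scheme \<Rightarrow> (('a \<Rightarrow> 'a) set \<Rightarrow> 'b \<Rightarrow> 'b) \<Rightarrow> bool" where
  "contravariant_derivative R P0 bracket0 P1 D \<longleftrightarrow>
    bilinear_over R (restrict_scalars P0 (kaehler R P0)) (restrict_scalars P0 P1)
      (restrict_scalars P0 P1) D \<and>
    (\<forall>f\<in>carrier P0. \<forall>\<alpha>\<in>carrier (kaehler R P0). \<forall>\<eta>\<in>carrier P1.
      D (f \<odot>\<^bsub>kaehler R P0\<^esub> \<alpha>) \<eta> = f \<odot>\<^bsub>P1\<^esub> D \<alpha> \<eta> \<and>
      D \<alpha> (f \<odot>\<^bsub>P1\<^esub> \<eta>) = f \<odot>\<^bsub>P1\<^esub> D \<alpha> \<eta> \<oplus>\<^bsub>P1\<^esub> anchor P0 bracket0 \<alpha> f \<odot>\<^bsub>P1\<^esub> \<eta>)"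

locale corresponding_poisson_triple =
  admissible_poisson_algebra R P0 bracket0 P1 bracket + bracket1: lie_algebra P0 P1 bracket1
  for R (structure) and P0 and bracket0 and P1 and bracket and bracket1 +
  fixes D K
  assumes contravariant_derivative: "contravariant_derivative R P0 bracket0 P1 D"
    and K_bilinear: "bilinear_over P0 (kaehler R P0) (kaehler R P0) P1 K"
    and K_skew:
      "\<lbrakk>\<alpha> \<in> carrier (kaehler R P0); \<beta> \<in> carrier (kaehler R P0)\<rbrakk> \<Longrightarrow> K \<alpha> \<beta> = \<ominus>\<^bsub>P1\<^esub> K \<beta> \<alpha>"
    and bracket_eq:
      "\<lbrakk>f \<in> carrier P0; g \<in> carrier P0; \<eta> \<in> carrier P1; \<xi> \<in> carrier P1\<rbrakk> \<Longrightarrow>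
        bracket (f, \<eta>) (g, \<xi>) =
          (bracket0 f g,
           D (kaehler_d R P0 f) \<xi> \<ominus>\<^bsub>P1\<^esub> D (kaehler_d R P0 g) \<eta>
             \<oplus>\<^bsub>P1\<^esub> bracket1 \<eta> \<xi> \<oplus>\<^bsub>P1\<^esub> K (kaehler_d R P0 f) (kaehler_d R P0 g))"

definition T_map ::
  "('r, 'k) ring_scheme \<Rightarrow> ('r, 'a, 'x) module_scheme \<Rightarrow> ('a, 'b, 'm) module_scheme
    \<Rightarrow> (('a \<Rightarrow> 'a) set \<Rightarrow> 'b \<Rightarrow> 'b) \<Rightarrow> (('a \<Rightarrow> 'a) set \<Rightarrow> ('a \<Rightarrow> 'a) set \<Rightarrow> 'b)
    \<Rightarrow> 'a \<times> 'b \<Rightarrow> 'a \<Rightarrow> 'b" where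
  "T_map R P0 P1 D K = (\<lambda>(f, \<eta>) g.
    K (kaehler_d R P0 f) (kaehler_d R P0 g) \<ominus>\<^bsub>P1\<^esub> D (kaehler_d R P0 g) \<eta>)"

definition T_kernel ::
  "('r, 'k) ring_scheme \<Rightarrow> ('r, 'a, 'x) module_scheme \<Rightarrow> ('a, 'b, 'm) module_scheme
    \<Rightarrow> (('a \<Rightarrow> 'a) set \<Rightarrow> 'b \<Rightarrow> 'b) \<Rightarrow> (('a \<Rightarrow> 'a) set \<Rightarrow> ('a \<Rightarrow> 'a) set \<Rightarrow> 'b) \<Rightarrow> ('a \<times> 'b) set" where
  "T_kernel R P0 P1 D K =
    {x \<in> carrier (trivial_extension P0 P1). \<forall>g\<in>carrier P0. T_map R P0 P1 D K x g = \<zero>\<^bsub>P1\<^esub>}"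


section \<open>Universal property of the Kaehler differentials and related facts\<close>

lemma module_free:
  fixes A (structure)
  assumes "cring A" shows "module A (free_module A B)"
proof -
  interpret A: cring A by fact
  show ?thesis
  proof (rule moduleI)
    show "cring A" by fact
    show "abelian_group (free_module A B)"
    proof (rule abelian_groupI)
      fix x y assume x: "x \<in> carrier (free_module A B)" and y: "y \<in> carrier (free_module A B)"
      have "{b. x b \<oplus> y b \<noteq> \<zero>} \<subseteq> {b. x b \<noteq> \<zero>} \<union> {b. y b \<noteq> \<zero>}" by auto
      then have "finite {b. x b \<oplus> y b \<noteq> \<zero>}"
        using x y by (auto simp: free_module_def intro: finite_subset)
      then show "x \<oplus>\<^bsub>free_module A B\<^esub> y \<in> carrier (free_module A B)"
        using x y by (auto simp: free_module_def)
    next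
      fix x assume x: "x \<in> carrier (free_module A B)"
      show "\<exists>y\<in>carrier (free_module A B). y \<oplus>\<^bsub>free_module A B\<^esub> x = \<zero>\<^bsub>free_module A B\<^esub>"
      proof (rule bexI[where x = "\<lambda>b. \<ominus> x b"])
        have "{b. \<ominus> x b \<noteq> \<zero>} \<subseteq> {b. x b \<noteq> \<zero>}" by auto
        then show "(\<lambda>b. \<ominus> x b) \<in> carrier (free_module A B)"
          using x by (auto simp: free_module_def intro: finite_subset)
      qed (use x in \<open>auto simp: free_module_def A.l_neg\<close>)
    qed (auto simp: free_module_def A.a_ac)
  next
    fix a x assume a: "a \<in> carrier A" and x: "x \<in> carrier (free_module A B)"
    have "{b. a \<otimes> x b \<noteq> \<zero>} \<subseteq> {b. x b \<noteq> \<zero>}" using a by auto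
    then have "finite {b. a \<otimes> x b \<noteq> \<zero>}"
      using x by (auto simp: free_module_def intro: finite_subset)
    then show "a \<odot>\<^bsub>free_module A B\<^esub> x \<in> carrier (free_module A B)"
      using a x by (auto simp: free_module_def)
  qed (auto simp: free_module_def A.l_distr A.r_distr A.m_assoc)
qed

lemma free_gen_closed:
  assumes "cring A" "b \<in> B" shows "free_gen A b \<in> carrier (free_module A B)"
proof -
  interpret A: cring A by fact
  have "{b'. free_gen A b b' \<noteq> \<zero>\<^bsub>A\<^esub>} \<subseteq> {b}" by (auto simp: free_gen_def)
  then have "finite {b'. free_gen A b b' \<noteq> \<zero>\<^bsub>A\<^esub>}" by (rule finite_subset) simp
  then show ?thesis using assms(2) by (auto simp: free_module_def free_gen_def)
qed

lemma module_regular_module: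
  assumes "cring A" shows "module A (regular_module A)"
proof -
  interpret A: cring A by fact
  show ?thesis
  proof (rule moduleI)
    show "abelian_group (regular_module A)"
    proof (rule abelian_groupI)
      fix x assume "x \<in> carrier (regular_module A)"
      then show "\<exists>y\<in>carrier (regular_module A). y \<oplus>\<^bsub>regular_module A\<^esub> x = \<zero>\<^bsub>regular_module A\<^esub>"
        by (intro bexI[where x = "\<ominus>\<^bsub>A\<^esub> x"]) (auto simp: regular_module_def A.l_neg)
    qed (auto simp: regular_module_def A.a_ac)
  qed (auto simp: regular_module_def A.l_distr A.r_distr A.m_assoc assms)
qed

lemma submodule_submodule_span:
  assumes "module A M" "S \<subseteq> carrier M"
  shows "submodule (submodule_span A M S) A M" and "S \<subseteq> submodule_span A M S"
proof -
  interpret module A M by fact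
  show "submodule (submodule_span A M S) A M"
  proof (rule submoduleI)
    show "submodule_span A M S \<subseteq> carrier M"
      using carrier_is_submodule assms(2) by (auto simp: submodule_span_def)
    show "\<zero>\<^bsub>M\<^esub> \<in> submodule_span A M S"
      by (auto simp: submodule_span_def dest!: submodule.axioms(1) subgroup.one_closed)
  qed (auto simp: submodule_span_def dest: submoduleE)
qed (auto simp: submodule_span_def)

lemma submodule_span_least:
  assumes "submodule H A M" "S \<subseteq> H" shows "submodule_span A M S \<subseteq> H"
  using assms by (auto simp: submodule_span_def)

context
  fixes A M N
  assumes M: "module A M" and N: "submodule N A M"
begin

interpretation module A M by (rule M)
interpretation N: abelian_subgroup N M
  by (rule abelian_subgroupI3)
    (simp_all add: additive_subgroup_def submodule.axioms(1)[OF N] M.abelian_group_axioms)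

lemma coset_add:
  assumes "x \<in> carrier M" "y \<in> carrier M"
  shows "(N +>\<^bsub>M\<^esub> x) \<oplus>\<^bsub>quotient_module M N\<^esub> (N +>\<^bsub>M\<^esub> y) = N +>\<^bsub>M\<^esub> (x \<oplus>\<^bsub>M\<^esub> y)"
  using assms by (simp add: quotient_module_def N.a_rcos_sum)

lemma coset_eq_iff:
  assumes "x \<in> carrier M" "y \<in> carrier M"
  shows "N +>\<^bsub>M\<^esub> x = N +>\<^bsub>M\<^esub> y \<longleftrightarrow> x \<ominus>\<^bsub>M\<^esub> y \<in> N"
proof
  have iff: "x \<in> N +>\<^bsub>M\<^esub> y \<longleftrightarrow> x \<ominus>\<^bsub>M\<^esub> y \<in> N"
    using assms by (simp add: N.a_rcos_module M.minus_eq)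
  show "x \<ominus>\<^bsub>M\<^esub> y \<in> N" if "N +>\<^bsub>M\<^esub> x = N +>\<^bsub>M\<^esub> y"
    using iff that N.a_rcos_self[OF assms(1)] by simp
  show "N +>\<^bsub>M\<^esub> x = N +>\<^bsub>M\<^esub> y" if "x \<ominus>\<^bsub>M\<^esub> y \<in> N"
    using M.a_repr_independence[OF iffD2[OF iff that] assms(2) N.a_subgroup] by (rule sym)
qed

lemma coset_smult:
  assumes "a \<in> carrier A" "x \<in> carrier M"
  shows "a \<odot>\<^bsub>quotient_module M N\<^esub> (N +>\<^bsub>M\<^esub> x) = N +>\<^bsub>M\<^esub> (a \<odot>\<^bsub>M\<^esub> x)"
proof -
  have *: "N +>\<^bsub>M\<^esub> (a \<odot>\<^bsub>M\<^esub> y) = N +>\<^bsub>M\<^esub> (a \<odot>\<^bsub>M\<^esub> x)" if y: "y \<in> N +>\<^bsub>M\<^esub> x" for y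
  proof -
    have yc: "y \<in> carrier M" using y assms N.a_elemrcos_carrier by blast
    have "N +>\<^bsub>M\<^esub> y = N +>\<^bsub>M\<^esub> x" using M.a_repr_independence[OF y assms(2) N.a_subgroup] ..
    then have "y \<ominus>\<^bsub>M\<^esub> x \<in> N" using coset_eq_iff yc assms by simp
    then have "a \<odot>\<^bsub>M\<^esub> (y \<ominus>\<^bsub>M\<^esub> x) \<in> N" using submodule.smult_closed[OF N] assms by simp
    then have "a \<odot>\<^bsub>M\<^esub> y \<ominus>\<^bsub>M\<^esub> a \<odot>\<^bsub>M\<^esub> x \<in> N"
      using assms yc by (simp add: M.minus_eq smult_r_distr smult_r_minus)
    then show ?thesis using coset_eq_iff yc assms by simp
  qed
  have "(\<Union>y\<in>N +>\<^bsub>M\<^esub> x. N +>\<^bsub>M\<^esub> (a \<odot>\<^bsub>M\<^esub> y)) = (\<Union>y\<in>N +>\<^bsub>M\<^esub> x. N +>\<^bsub>M\<^esub> (a \<odot>\<^bsub>M\<^esub> x))"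
    by (rule SUP_cong[OF refl *])
  also have "\<dots> = N +>\<^bsub>M\<^esub> (a \<odot>\<^bsub>M\<^esub> x)"
    using N.a_rcos_self[OF assms(2)] by blast
  finally show ?thesis by (simp add: quotient_module_def)
qed

lemma carrier_quotient: "carrier (quotient_module M N) = (\<lambda>x. N +>\<^bsub>M\<^esub> x) ` carrier M"
  by (auto simp: quotient_module_def A_RCOSETS_def')

lemma zero_quotient: "\<zero>\<^bsub>quotient_module M N\<^esub> = N +>\<^bsub>M\<^esub> \<zero>\<^bsub>M\<^esub>"
  by (simp add: quotient_module_def M.a_coset_add_zero[OF N.a_subset])

lemma module_quotient: "module A (quotient_module M N)"
proof (rule moduleI)
  show "abelian_group (quotient_module M N)"
  proof (rule abelian_groupI)
    fix x assume "x \<in> carrier (quotient_module M N)"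
    then obtain x' where x': "x = N +>\<^bsub>M\<^esub> x'" "x' \<in> carrier M" by (auto simp: carrier_quotient)
    then show "\<exists>y\<in>carrier (quotient_module M N). y \<oplus>\<^bsub>quotient_module M N\<^esub> x = \<zero>\<^bsub>quotient_module M N\<^esub>"
      by (intro bexI[where x = "N +>\<^bsub>M\<^esub> (\<ominus>\<^bsub>M\<^esub> x')"])
        (auto simp: carrier_quotient zero_quotient coset_add M.l_neg)
  qed (auto simp: carrier_quotient zero_quotient coset_add M.a_ac)
qed (auto simp: carrier_quotient coset_add coset_smult smult_l_distr smult_r_distr smult_assoc1
      intro: R.cring_axioms)

end

context
  fixes A M and D :: "'b \<Rightarrow> 'c" and B :: "'b set"
  assumes M: "module A M" and D: "\<And>b. b \<in> B \<Longrightarrow> D b \<in> carrier M"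
begin

interpretation module A M by (rule M)

lemma free_lift_superset:
  assumes c: "c \<in> carrier (free_module A B)" and "finite S" "S \<subseteq> B" "{b. c b \<noteq> \<zero>\<^bsub>A\<^esub>} \<subseteq> S"
  shows "free_lift A M D c = (\<Oplus>\<^bsub>M\<^esub>b\<in>S. c b \<odot>\<^bsub>M\<^esub> D b)"
  unfolding free_lift_def
  by (rule M.add.finprod_mono_neutral_cong_left)
    (use assms D in \<open>auto simp: free_module_def\<close>)

lemma free_lift_linear: "linear_over A (free_module A B) M (free_lift A M D)"
proof -
  interpret F: module A "free_module A B" by (rule module_free) (rule R.cring_axioms)
  have supp: "finite {b. c b \<noteq> \<zero>\<^bsub>A\<^esub>}" "{b. c b \<noteq> \<zero>\<^bsub>A\<^esub>} \<subseteq> B" "\<And>b. c b \<in> carrier A"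
    if "c \<in> carrier (free_module A B)" for c
    using that by (auto simp: free_module_def)
  show ?thesis unfolding linear_over_def
  proof (intro conjI ballI)
    fix c assume c: "c \<in> carrier (free_module A B)"
    show "free_lift A M D c \<in> carrier M"
      unfolding free_lift_def using supp[OF c] D by (intro M.finsum_closed) auto
    fix c' assume c': "c' \<in> carrier (free_module A B)"
    let ?S = "{b. c b \<noteq> \<zero>\<^bsub>A\<^esub>} \<union> {b. c' b \<noteq> \<zero>\<^bsub>A\<^esub>}"
    have S: "finite ?S" "?S \<subseteq> B" using supp[OF c] supp[OF c'] by auto
    have fin: "finite {b. c b \<oplus>\<^bsub>A\<^esub> c' b \<noteq> \<zero>\<^bsub>A\<^esub>}"
      by (rule finite_subset[OF _ S(1)]) auto
    have "free_lift A M D (c \<oplus>\<^bsub>free_module A B\<^esub> c') =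
        (\<Oplus>\<^bsub>M\<^esub>b\<in>?S. (c b \<oplus>\<^bsub>A\<^esub> c' b) \<odot>\<^bsub>M\<^esub> D b)"
      by (subst free_lift_superset[where S = ?S]) (use S fin c c' in \<open>auto simp: free_module_def\<close>)
    also have "\<dots> = (\<Oplus>\<^bsub>M\<^esub>b\<in>?S. c b \<odot>\<^bsub>M\<^esub> D b \<oplus>\<^bsub>M\<^esub> c' b \<odot>\<^bsub>M\<^esub> D b)"
      by (rule M.finsum_cong') (use S D supp[OF c] supp[OF c'] in \<open>auto intro!: smult_l_distr\<close>)
    also have "\<dots> = (\<Oplus>\<^bsub>M\<^esub>b\<in>?S. c b \<odot>\<^bsub>M\<^esub> D b) \<oplus>\<^bsub>M\<^esub> (\<Oplus>\<^bsub>M\<^esub>b\<in>?S. c' b \<odot>\<^bsub>M\<^esub> D b)"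
      by (rule M.finsum_addf) (use S D supp[OF c] supp[OF c'] in auto)
    also have "\<dots> = free_lift A M D c \<oplus>\<^bsub>M\<^esub> free_lift A M D c'"
      using S c c' by (simp add: free_lift_superset[where S = ?S])
    finally show "free_lift A M D (c \<oplus>\<^bsub>free_module A B\<^esub> c') = \<dots>" .
  next
    fix a c assume a: "a \<in> carrier A" and c: "c \<in> carrier (free_module A B)"
    let ?S = "{b. c b \<noteq> \<zero>\<^bsub>A\<^esub>}"
    have "free_lift A M D (a \<odot>\<^bsub>free_module A B\<^esub> c) = (\<Oplus>\<^bsub>M\<^esub>b\<in>?S. (a \<otimes>\<^bsub>A\<^esub> c b) \<odot>\<^bsub>M\<^esub> D b)"
      by (subst free_lift_superset[where S = ?S])
        (use supp[OF c] a c F.smult_closed[OF a c] in \<open>auto simp: free_module_def\<close>)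
    also have "\<dots> = (\<Oplus>\<^bsub>M\<^esub>b\<in>?S. a \<odot>\<^bsub>M\<^esub> (c b \<odot>\<^bsub>M\<^esub> D b))"
      by (rule M.finsum_cong') (use D a supp[OF c] in \<open>auto intro!: smult_assoc1\<close>)
    also have "\<dots> = a \<odot>\<^bsub>M\<^esub> free_lift A M D c"
      unfolding free_lift_def
      by (rule finsum_smult_ldistr[symmetric]) (use D a supp[OF c] in auto)
    finally show "free_lift A M D (a \<odot>\<^bsub>free_module A B\<^esub> c) = \<dots>" .
  qed
qed

lemma free_lift_gen:
  assumes "b \<in> B" shows "free_lift A M D (free_gen A b) = D b"
  using assms D
  by (subst free_lift_superset[where S = "{b}"])
    (auto simp: free_gen_def free_gen_closed[OF R.cring_axioms, unfolded free_gen_def])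

end

lemma linear_over_diff:
  assumes "module A M" "module A N" "linear_over A M N L" "x \<in> carrier M" "y \<in> carrier M"
  shows "L (x \<ominus>\<^bsub>M\<^esub> y) = L x \<ominus>\<^bsub>N\<^esub> L y"
proof -
  interpret M: module A M by fact
  interpret N: module A N by fact
  have neg: "\<ominus>\<^bsub>M\<^esub> y = (\<ominus>\<^bsub>A\<^esub> \<one>\<^bsub>A\<^esub>) \<odot>\<^bsub>M\<^esub> y" using assms by (simp add: M.smult_l_minus)
  show ?thesis using assms(3-5) unfolding M.minus_eq N.minus_eq
    by (subst neg) (simp add: linear_over_def N.smult_l_minus)
qed

lemma linear_over_kernel:
  assumes "module A M" "module A N" "linear_over A M N L"
  shows "submodule {x \<in> carrier M. L x = \<zero>\<^bsub>N\<^esub>} A M"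
proof -
  interpret M: module A M by fact
  interpret N: module A N by fact
  have L: "\<And>x y. x \<in> carrier M \<Longrightarrow> y \<in> carrier M \<Longrightarrow> L (x \<oplus>\<^bsub>M\<^esub> y) = L x \<oplus>\<^bsub>N\<^esub> L y"
    "\<And>a x. a \<in> carrier A \<Longrightarrow> x \<in> carrier M \<Longrightarrow> L (a \<odot>\<^bsub>M\<^esub> x) = a \<odot>\<^bsub>N\<^esub> L x"
    "\<And>x. x \<in> carrier M \<Longrightarrow> L x \<in> carrier N"
    using assms(3) by (auto simp: linear_over_def)
  have neg: "L (\<ominus>\<^bsub>M\<^esub> x) = \<ominus>\<^bsub>N\<^esub> L x" if "x \<in> carrier M" for x
    using L(2)[of "\<ominus>\<^bsub>A\<^esub> \<one>\<^bsub>A\<^esub>" x] L(3) that by (simp add: M.smult_l_minus N.smult_l_minus)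
  have "L \<zero>\<^bsub>M\<^esub> = \<zero>\<^bsub>N\<^esub>"
    using L(2)[of "\<zero>\<^bsub>A\<^esub>" "\<zero>\<^bsub>M\<^esub>"] L(3) by simp
  then show ?thesis by (intro M.submoduleI) (auto simp: L neg)
qed

context algebra
begin

lemma module_kaehler_free: "module M (kaehler_free M)"
  unfolding kaehler_free_def by (rule module_free) (rule M_cring)

interpretation F: module M "kaehler_free M" by (rule module_kaehler_free)

lemma free_gen_kaehler: "f \<in> carrier M \<Longrightarrow> free_gen M f \<in> carrier (kaehler_free M)"
  unfolding kaehler_free_def by (rule free_gen_closed[OF M_cring])

lemma kaehler_relations_subset: "kaehler_relations R M \<subseteq> carrier (kaehler_free M)"
  by (auto simp: kaehler_relations_def Let_def free_gen_kaehler)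

lemmas submodule_kaehler =
  submodule_submodule_span[OF module_kaehler_free kaehler_relations_subset,
    folded kaehler_submodule_def]

lemma module_kaehler: "module M (kaehler R M)"
  unfolding kaehler_def by (rule module_quotient[OF module_kaehler_free submodule_kaehler(1)])

lemmas kcoset = coset_add[OF module_kaehler_free submodule_kaehler(1), folded kaehler_def]
  coset_smult[OF module_kaehler_free submodule_kaehler(1), folded kaehler_def]

lemmas kcoset_eq = coset_eq_iff[OF module_kaehler_free submodule_kaehler(1)]

lemmas carrier_kaehler =
  carrier_quotient[OF module_kaehler_free submodule_kaehler(1), folded kaehler_def]

lemma derivation_kaehler_d: "derivation R M (kaehler R M) (kaehler_d R M)"
  unfolding derivation_def linear_over_def
proof (intro conjI ballI)
  fix f g assume f: "f \<in> carrier M" and g: "g \<in> carrier M"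
  show "kaehler_d R M f \<in> carrier (restrict_scalars M (kaehler R M))"
    using f by (auto simp: restrict_scalars_def kaehler_d_def carrier_kaehler free_gen_kaehler)
  have "free_gen M (f \<oplus>\<^bsub>M\<^esub> g) \<ominus>\<^bsub>kaehler_free M\<^esub>
      (free_gen M f \<oplus>\<^bsub>kaehler_free M\<^esub> free_gen M g) \<in> kaehler_submodule R M"
    by (rule subsetD[OF submodule_kaehler(2)], unfold kaehler_relations_def Let_def) (use f g in blast)
  then show "kaehler_d R M (f \<oplus>\<^bsub>M\<^esub> g)
      = kaehler_d R M f \<oplus>\<^bsub>restrict_scalars M (kaehler R M)\<^esub> kaehler_d R M g"
    using f g by (simp add: restrict_scalars_def kaehler_d_def kcoset kcoset_eq free_gen_kaehler)
  have "free_gen M (f \<otimes>\<^bsub>M\<^esub> g) \<ominus>\<^bsub>kaehler_free M\<^esub>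
      (f \<odot>\<^bsub>kaehler_free M\<^esub> free_gen M g \<oplus>\<^bsub>kaehler_free M\<^esub> g \<odot>\<^bsub>kaehler_free M\<^esub> free_gen M f)
      \<in> kaehler_submodule R M"
    by (rule subsetD[OF submodule_kaehler(2)], unfold kaehler_relations_def Let_def) (use f g in blast)
  then show "kaehler_d R M (f \<otimes>\<^bsub>M\<^esub> g)
      = f \<odot>\<^bsub>kaehler R M\<^esub> kaehler_d R M g \<oplus>\<^bsub>kaehler R M\<^esub> g \<odot>\<^bsub>kaehler R M\<^esub> kaehler_d R M f"
    using f g by (simp add: kaehler_d_def kcoset kcoset_eq free_gen_kaehler)
next
  fix r f assume r: "r \<in> carrier R" and f: "f \<in> carrier M"
  have "free_gen M (r \<odot>\<^bsub>M\<^esub> f) \<ominus>\<^bsub>kaehler_free M\<^esub>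
      (r \<odot>\<^bsub>M\<^esub> \<one>\<^bsub>M\<^esub>) \<odot>\<^bsub>kaehler_free M\<^esub> free_gen M f \<in> kaehler_submodule R M"
    by (rule subsetD[OF submodule_kaehler(2)], unfold kaehler_relations_def Let_def) (use r f in blast)
  then show "kaehler_d R M (r \<odot>\<^bsub>M\<^esub> f)
      = r \<odot>\<^bsub>restrict_scalars M (kaehler R M)\<^esub> kaehler_d R M f"
    using r f by (simp add: restrict_scalars_def kaehler_d_def kcoset kcoset_eq free_gen_kaehler)
qed

lemma free_lift_kaehler_submodule:
  assumes N: "module M N" and D: "derivation R M N D" and c: "c \<in> kaehler_submodule R M"
  shows "free_lift M N D c = \<zero>\<^bsub>N\<^esub>"
proof -
  interpret N: module M N by fact
  have Dc: "\<And>f. f \<in> carrier M \<Longrightarrow> D f \<in> carrier N"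
    using D by (auto simp: derivation_def linear_over_def restrict_scalars_def)
  have lin: "linear_over M (kaehler_free M) N (free_lift M N D)"
    unfolding kaehler_free_def by (rule free_lift_linear[OF N Dc])
  have lift_gen: "\<And>f. f \<in> carrier M \<Longrightarrow> free_lift M N D (free_gen M f) = D f"
    by (rule free_lift_gen[OF N, where B = "carrier M"]) (use Dc in auto)
  have l: "\<And>x y. x \<in> carrier (kaehler_free M) \<Longrightarrow> y \<in> carrier (kaehler_free M) \<Longrightarrow>
      free_lift M N D (x \<oplus>\<^bsub>kaehler_free M\<^esub> y) = free_lift M N D x \<oplus>\<^bsub>N\<^esub> free_lift M N D y"
    "\<And>a x. a \<in> carrier M \<Longrightarrow> x \<in> carrier (kaehler_free M) \<Longrightarrow>
      free_lift M N D (a \<odot>\<^bsub>kaehler_free M\<^esub> x) = a \<odot>\<^bsub>N\<^esub> free_lift M N D x"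
    using lin by (auto simp: linear_over_def)
  have "kaehler_relations R M \<subseteq> {x \<in> carrier (kaehler_free M). free_lift M N D x = \<zero>\<^bsub>N\<^esub>}"
    using D kaehler_relations_subset
    by (auto simp: kaehler_relations_def Let_def free_gen_kaehler lift_gen Dc l
        linear_over_diff[OF module_kaehler_free N lin] derivation_def linear_over_def
        restrict_scalars_def N.M.minus_eq N.M.r_neg)
  from submodule_span_least[OF linear_over_kernel[OF module_kaehler_free N lin] this] c
  show ?thesis by (auto simp: kaehler_submodule_def)
qed

lemma kaehler_universal:
  assumes N: "module M N" and D: "derivation R M N D"
  shows "linear_over M (kaehler R M) N (kaehler_lift M N D)"
    and "\<And>f. f \<in> carrier M \<Longrightarrow> kaehler_lift M N D (kaehler_d R M f) = D f"
    and "\<And>L \<alpha>. \<lbrakk>linear_over M (kaehler R M) N L;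
        \<And>f. f \<in> carrier M \<Longrightarrow> L (kaehler_d R M f) = D f; \<alpha> \<in> carrier (kaehler R M)\<rbrakk> \<Longrightarrow>
        L \<alpha> = kaehler_lift M N D \<alpha>"
proof -
  interpret N: module M N by fact
  have Dc: "\<And>f. f \<in> carrier M \<Longrightarrow> D f \<in> carrier N"
    using D by (auto simp: derivation_def linear_over_def restrict_scalars_def)
  have lin: "linear_over M (kaehler_free M) N (free_lift M N D)"
    unfolding kaehler_free_def by (rule free_lift_linear[OF N Dc])
  have lift_gen: "\<And>f. f \<in> carrier M \<Longrightarrow> free_lift M N D (free_gen M f) = D f"
    by (rule free_lift_gen[OF N, where B = "carrier M"]) (use Dc in auto)
  have add: "free_lift M N D (x \<oplus>\<^bsub>kaehler_free M\<^esub> y) = free_lift M N D x \<oplus>\<^bsub>N\<^esub> free_lift M N D y"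
    if "x \<in> carrier (kaehler_free M)" "y \<in> carrier (kaehler_free M)" for x y
    using lin that by (simp add: linear_over_def)
  have smult: "free_lift M N D (a \<odot>\<^bsub>kaehler_free M\<^esub> x) = a \<odot>\<^bsub>N\<^esub> free_lift M N D x"
    if "a \<in> carrier M" "x \<in> carrier (kaehler_free M)" for a x
    using lin that by (simp add: linear_over_def)
  have closed: "free_lift M N D x \<in> carrier N" if "x \<in> carrier (kaehler_free M)" for x
    using lin that by (simp add: linear_over_def)
  let ?F = "kaehler_free M" and ?S = "kaehler_submodule R M"
  have S: "?S \<subseteq> carrier ?F" using F.submoduleE(1)[OF submodule_kaehler(1)] .
  have zS: "\<zero>\<^bsub>?F\<^esub> \<in> ?S"
    using subgroup.one_closed[OF submodule.axioms(1)[OF submodule_kaehler(1)]] by simp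
  have lift: "kaehler_lift M N D (?S +>\<^bsub>?F\<^esub> x) = free_lift M N D x" if x: "x \<in> carrier ?F" for x
  proof -
    have eq: "free_lift M N D c = free_lift M N D x" if "c \<in> ?S +>\<^bsub>?F\<^esub> x" for c
    proof -
      from that obtain s where s: "s \<in> ?S" "c = s \<oplus>\<^bsub>?F\<^esub> x" by (auto simp: a_r_coset_def')
      then have "s \<in> carrier ?F" using S by blast
      then show ?thesis
        unfolding s(2) using x
        by (simp add: add free_lift_kaehler_submodule[OF N D s(1)] closed)
    qed
    have "\<zero>\<^bsub>?F\<^esub> \<oplus>\<^bsub>?F\<^esub> x \<in> ?S +>\<^bsub>?F\<^esub> x" using zS unfolding a_r_coset_def' by blast
    then have self: "x \<in> ?S +>\<^bsub>?F\<^esub> x" using x by simp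
    show ?thesis unfolding kaehler_lift_def
      by (rule the_equality) (use eq in blast, use self in \<open>auto dest: bspec\<close>)
  qed
  show lin': "linear_over M (kaehler R M) N (kaehler_lift M N D)"
    unfolding linear_over_def carrier_kaehler by (auto simp: kcoset lift add smult closed)
  show d: "kaehler_lift M N D (kaehler_d R M f) = D f" if "f \<in> carrier M" for f
    using that by (simp add: kaehler_d_def lift free_gen_kaehler lift_gen)
  fix L \<alpha> assume L: "linear_over M (kaehler R M) N L"
    and Ld: "\<And>f. f \<in> carrier M \<Longrightarrow> L (kaehler_d R M f) = D f" and \<alpha>: "\<alpha> \<in> carrier (kaehler R M)"
  interpret K: module M "kaehler R M" by (rule module_kaehler)
  have cosetK: "?S +>\<^bsub>?F\<^esub> x \<in> carrier (kaehler R M)" if "x \<in> carrier ?F" for x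
    using that by (auto simp: carrier_kaehler)
  have gen: "L (?S +>\<^bsub>?F\<^esub> x) = free_lift M N D x"
    if "finite I" "x \<in> carrier ?F" "{f. x f \<noteq> \<zero>\<^bsub>M\<^esub>} = I" for x I
    using that
  proof (induction I arbitrary: x rule: finite_induct)
    case empty
    then have x: "x = \<zero>\<^bsub>?F\<^esub>" by (auto simp: kaehler_free_def free_module_def)
    have "L \<zero>\<^bsub>kaehler R M\<^esub> = \<zero>\<^bsub>N\<^esub>"
      using subgroup.one_closed[OF submodule.axioms(1)[OF linear_over_kernel[OF module_kaehler N L]]]
      by simp
    moreover have "\<zero>\<^bsub>kaehler R M\<^esub> = ?S +>\<^bsub>?F\<^esub> \<zero>\<^bsub>?F\<^esub>"
      unfolding kaehler_def
      by (rule zero_quotient[OF module_kaehler_free submodule_kaehler(1)])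
    ultimately show ?case using x by (simp add: free_lift_def kaehler_free_def free_module_def)
  next
    case (insert f I)
    define y where "y = (\<lambda>g. if g = f then \<zero>\<^bsub>M\<^esub> else x g)"
    have f: "f \<in> carrier M" "x f \<in> carrier M"
      using insert by (auto simp: kaehler_free_def free_module_def)
    have "finite {g. y g \<noteq> \<zero>\<^bsub>M\<^esub>}"
      using insert by (auto simp: y_def elim!: finite_subset[rotated])
    then have y: "y \<in> carrier ?F" "{g. y g \<noteq> \<zero>\<^bsub>M\<^esub>} = I"
      using insert by (auto simp: kaehler_free_def free_module_def y_def)
    have x: "x = x f \<odot>\<^bsub>?F\<^esub> free_gen M f \<oplus>\<^bsub>?F\<^esub> y"
      using insert f by (auto simp: kaehler_free_def free_module_def y_def free_gen_def fun_eq_iff)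
    have xf: "x f \<odot>\<^bsub>?F\<^esub> free_gen M f \<in> carrier ?F" using f by (simp add: free_gen_kaehler)
    have "L (?S +>\<^bsub>?F\<^esub> (x f \<odot>\<^bsub>?F\<^esub> free_gen M f \<oplus>\<^bsub>?F\<^esub> y))
        = x f \<odot>\<^bsub>N\<^esub> D f \<oplus>\<^bsub>N\<^esub> L (?S +>\<^bsub>?F\<^esub> y)"
      using L Ld[OF f(1)] f y cosetK[OF y(1)] cosetK[OF free_gen_kaehler[OF f(1)]]
      by (simp add: kcoset[symmetric] free_gen_kaehler linear_over_def kaehler_d_def)
    also have "\<dots> = free_lift M N D (x f \<odot>\<^bsub>?F\<^esub> free_gen M f \<oplus>\<^bsub>?F\<^esub> y)"
      using lin f xf y insert.IH[OF y]
      by (simp add: linear_over_def free_gen_kaehler lift_gen)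
    finally show ?case unfolding x[symmetric] .
  qed
  show "L \<alpha> = kaehler_lift M N D \<alpha>"
  proof -
    obtain x where x: "x \<in> carrier ?F" "\<alpha> = ?S +>\<^bsub>?F\<^esub> x" using \<alpha> by (auto simp: carrier_kaehler)
    have "finite {f. x f \<noteq> \<zero>\<^bsub>M\<^esub>}" using x(1) by (simp add: kaehler_free_def free_module_def)
    from gen[OF this x(1) refl] show ?thesis using x by (simp add: lift)
  qed
qed

end

lemma algebra_trivial_extension:
  assumes "algebra R P0" "module P0 P1" shows "algebra R (trivial_extension P0 P1)"
proof -
  interpret C: cring P0 using assms(1) by (rule algebra.M_cring)
  interpret P0: algebra R P0 by fact
  interpret P1: module P0 P1 by fact
  have s: "(r \<odot>\<^bsub>P0\<^esub> \<one>\<^bsub>P0\<^esub>) \<otimes>\<^bsub>P0\<^esub> f = r \<odot>\<^bsub>P0\<^esub> f" if "r \<in> carrier R" "f \<in> carrier P0" for r f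
    using that by (simp add: P0.smult_assoc2)
  have t: "f \<otimes>\<^bsub>P0\<^esub> (r \<odot>\<^bsub>P0\<^esub> g) = r \<odot>\<^bsub>P0\<^esub> (f \<otimes>\<^bsub>P0\<^esub> g)"
    if "r \<in> carrier R" "f \<in> carrier P0" "g \<in> carrier P0" for r f g
    using that P0.smult_assoc2[of r g f] by (simp add: C.m_comm)
  have u: "r \<odot>\<^bsub>P0\<^esub> (q \<odot>\<^bsub>P0\<^esub> f) = q \<odot>\<^bsub>P0\<^esub> (r \<odot>\<^bsub>P0\<^esub> f)"
    if "r \<in> carrier R" "q \<in> carrier R" "f \<in> carrier P0" for r q f
    using that by (simp add: P0.smult_assoc1[symmetric] P0.R.m_comm)
  show ?thesis
  proof (rule algebraI)
    show "cring R" by (rule P0.R_cring)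
    have "abelian_group (trivial_extension P0 P1)"
    proof (rule abelian_groupI)
      fix x assume x: "x \<in> carrier (trivial_extension P0 P1)"
      show "\<exists>y\<in>carrier (trivial_extension P0 P1).
          y \<oplus>\<^bsub>trivial_extension P0 P1\<^esub> x = \<zero>\<^bsub>trivial_extension P0 P1\<^esub>"
        by (rule bexI[where x = "(\<ominus>\<^bsub>P0\<^esub> fst x, \<ominus>\<^bsub>P1\<^esub> snd x)"])
          (use x in \<open>auto simp: trivial_extension_def C.l_neg P1.M.l_neg\<close>)
    qed (auto simp: trivial_extension_def C.a_ac P1.M.a_ac)
    moreover have "comm_monoid (trivial_extension P0 P1)"
      by (rule comm_monoidI)
        (auto simp: trivial_extension_def C.m_ac P1.M.a_ac P1.smult_r_distr
          P1.smult_assoc1[symmetric])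
    ultimately show "cring (trivial_extension P0 P1)"
      by (rule cringI)
        (auto simp: trivial_extension_def C.l_distr P1.M.a_ac P1.smult_r_distr P1.smult_l_distr)
  qed (auto simp: trivial_extension_def P0.smult_l_distr P0.smult_r_distr P1.smult_l_distr
      P1.smult_r_distr P0.smult_assoc1 P1.smult_assoc1[symmetric] s t u P0.smult_assoc2)
qed

lemma (in poisson_algebra) anchor_kaehler_d:
  assumes h: "h \<in> carrier A" and f: "f \<in> carrier A"
  shows "anchor A bracket (kaehler_d R A h) f = bracket h f"
proof -
  have "derivation R A (regular_module A) (\<lambda>h. bracket h f)"
    using bracket_bilinear f leibniz_left
    by (auto simp: derivation_def linear_over_def bilinear_over_def restrict_scalars_def
        regular_module_def smult_assoc2)
  from kaehler_universal(2)[OF module_regular_module[OF M_cring] this h] show ?thesis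
    by (simp add: anchor_def)
qed

end

theory Submission
  imports Defs
begin

text \<open>
  By the bracket formula, the \<open>P1\<close>-component of \<open>{k \<oplus> \<zeta>, g \<oplus> \<xi>}\<close> is
  \<open>(D\<^bsub>dk\<^esub> \<xi> + [\<zeta>, \<xi>]) + T g\<close>, a sum of an additive function of \<open>\<xi>\<close> and an additive function
  of \<open>g\<close>. Such a sum vanishes identically iff both summands do: put \<open>\<xi> = 0\<close>, respectively
  \<open>g = 0\<close>.
\<close>

context corresponding_poisson_triple
begin

text \<open>\<open>restrict_scalars\<close> keeps carrier, zero and addition, so closure and
  additivity of the universal derivation hold in \<open>kaehler R P0\<close> itself. The same remark
  transfers the \<open>R\<close>-bilinearity of \<open>D\<close> to the unrestricted modules in
  \<open>D_closed\<close> and its companions.\<close>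

lemma kaehler_d_closed: "f \<in> carrier P0 \<Longrightarrow> kaehler_d R P0 f \<in> carrier (kaehler R P0)"
  and kaehler_d_add: "\<lbrakk>f \<in> carrier P0; g \<in> carrier P0\<rbrakk> \<Longrightarrow>
    kaehler_d R P0 (f \<oplus>\<^bsub>P0\<^esub> g) = kaehler_d R P0 f \<oplus>\<^bsub>kaehler R P0\<^esub> kaehler_d R P0 g"
  using P0.derivation_kaehler_d by (auto simp: derivation_def linear_over_def restrict_scalars_def)

lemma D_closed: "\<lbrakk>\<alpha> \<in> carrier (kaehler R P0); \<eta> \<in> carrier P1\<rbrakk> \<Longrightarrow> D \<alpha> \<eta> \<in> carrier P1"
  and D_add_left: "\<lbrakk>\<alpha> \<in> carrier (kaehler R P0); \<beta> \<in> carrier (kaehler R P0); \<eta> \<in> carrier P1\<rbrakk> \<Longrightarrow>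
    D (\<alpha> \<oplus>\<^bsub>kaehler R P0\<^esub> \<beta>) \<eta> = D \<alpha> \<eta> \<oplus>\<^bsub>P1\<^esub> D \<beta> \<eta>"
  and D_add_right: "\<lbrakk>\<alpha> \<in> carrier (kaehler R P0); \<eta> \<in> carrier P1; \<xi> \<in> carrier P1\<rbrakk> \<Longrightarrow>
    D \<alpha> (\<eta> \<oplus>\<^bsub>P1\<^esub> \<xi>) = D \<alpha> \<eta> \<oplus>\<^bsub>P1\<^esub> D \<alpha> \<xi>"
  using contravariant_derivative
  by (auto simp: contravariant_derivative_def bilinear_over_def restrict_scalars_def)

lemma K_closed: "\<lbrakk>\<alpha> \<in> carrier (kaehler R P0); \<beta> \<in> carrier (kaehler R P0)\<rbrakk> \<Longrightarrow> K \<alpha> \<beta> \<in> carrier P1"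
  and K_add_right:
    "\<lbrakk>\<alpha> \<in> carrier (kaehler R P0); \<beta> \<in> carrier (kaehler R P0); \<gamma> \<in> carrier (kaehler R P0)\<rbrakk> \<Longrightarrow>
      K \<alpha> (\<beta> \<oplus>\<^bsub>kaehler R P0\<^esub> \<gamma>) = K \<alpha> \<beta> \<oplus>\<^bsub>P1\<^esub> K \<alpha> \<gamma>"
  using K_bilinear by (auto simp: bilinear_over_def)

lemma bracket1_closed: "\<lbrakk>\<eta> \<in> carrier P1; \<xi> \<in> carrier P1\<rbrakk> \<Longrightarrow> bracket1 \<eta> \<xi> \<in> carrier P1"
  and bracket1_add_right: "\<lbrakk>\<eta> \<in> carrier P1; \<xi> \<in> carrier P1; \<xi>' \<in> carrier P1\<rbrakk> \<Longrightarrow>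
    bracket1 \<eta> (\<xi> \<oplus>\<^bsub>P1\<^esub> \<xi>') = bracket1 \<eta> \<xi> \<oplus>\<^bsub>P1\<^esub> bracket1 \<eta> \<xi>'"
  using bracket1.bracket_bilinear by (auto simp: bilinear_over_def)

lemma T_map_closed:
  "\<lbrakk>f \<in> carrier P0; \<eta> \<in> carrier P1; g \<in> carrier P0\<rbrakk> \<Longrightarrow> T_map R P0 P1 D K (f, \<eta>) g \<in> carrier P1"
  by (simp add: T_map_def K_closed D_closed kaehler_d_closed)

text \<open>By additivity the value \<open>u\<close> at zero satisfies \<open>u = u + u\<close>, and
  cancellation in \<open>P1\<close> gives \<open>u = 0\<close>. The same argument serves for
  \<open>bracket1_zero_right\<close>.\<close>

lemma D_zero_right:
  assumes "\<alpha> \<in> carrier (kaehler R P0)" shows "D \<alpha> \<zero>\<^bsub>P1\<^esub> = \<zero>\<^bsub>P1\<^esub>"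
  using D_add_right[OF assms, of "\<zero>\<^bsub>P1\<^esub>" "\<zero>\<^bsub>P1\<^esub>"] D_closed[OF assms, of "\<zero>\<^bsub>P1\<^esub>"]
  by (simp add: P1.M.add.r_cancel_one)

lemma bracket1_zero_right:
  assumes "\<eta> \<in> carrier P1" shows "bracket1 \<eta> \<zero>\<^bsub>P1\<^esub> = \<zero>\<^bsub>P1\<^esub>"
  using bracket1_add_right[OF assms, of "\<zero>\<^bsub>P1\<^esub>" "\<zero>\<^bsub>P1\<^esub>"] bracket1_closed[OF assms, of "\<zero>\<^bsub>P1\<^esub>"]
  by (simp add: P1.M.add.r_cancel_one)

lemma T_map_zero:
  assumes f: "f \<in> carrier P0" and \<eta>: "\<eta> \<in> carrier P1"
  shows "T_map R P0 P1 D K (f, \<eta>) \<zero>\<^bsub>P0\<^esub> = \<zero>\<^bsub>P1\<^esub>"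
proof -
  \<comment> \<open>The differential of zero enters through the doubling identity
    \<open>d0 = d0 + d0\<close>. Read from right to left, it collapses the additivity equations of
    \<open>K\<close> and \<open>D\<close> in this argument to \<open>u = u + u\<close>, so both
    values vanish.\<close>
  have d0: "kaehler_d R P0 \<zero>\<^bsub>P0\<^esub> \<in> carrier (kaehler R P0)"
    "kaehler_d R P0 \<zero>\<^bsub>P0\<^esub> =
      kaehler_d R P0 \<zero>\<^bsub>P0\<^esub> \<oplus>\<^bsub>kaehler R P0\<^esub> kaehler_d R P0 \<zero>\<^bsub>P0\<^esub>"
    using kaehler_d_add[of "\<zero>\<^bsub>P0\<^esub>" "\<zero>\<^bsub>P0\<^esub>"] by (simp_all add: kaehler_d_closed)
  have "K (kaehler_d R P0 f) (kaehler_d R P0 \<zero>\<^bsub>P0\<^esub>) = \<zero>\<^bsub>P1\<^esub>"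
    using K_add_right[OF kaehler_d_closed[OF f] d0(1) d0(1)] K_closed[OF kaehler_d_closed[OF f] d0(1)]
    by (simp add: d0(2)[symmetric] P1.M.add.r_cancel_one)
  moreover have "D (kaehler_d R P0 \<zero>\<^bsub>P0\<^esub>) \<eta> = \<zero>\<^bsub>P1\<^esub>"
    using D_add_left[OF d0(1) d0(1) \<eta>] D_closed[OF d0(1) \<eta>]
    by (simp add: d0(2)[symmetric] P1.M.add.r_cancel_one)
  ultimately show ?thesis by (simp add: T_map_def P1.M.minus_eq)
qed

text \<open>Regrouping the bracket formula separates the variables: \<open>T_map\<close> collects
  the terms \<open>K(df,dg)\<close> and \<open>-D_dg \<eta>\<close>, which involve \<open>g\<close>
  but not \<open>\<xi>\<close>, while the first two terms involve \<open>\<xi>\<close> but not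
  \<open>g\<close>.\<close>

lemma bracket_T_map:
  assumes "f \<in> carrier P0" "g \<in> carrier P0" "\<eta> \<in> carrier P1" "\<xi> \<in> carrier P1"
  shows "bracket (f, \<eta>) (g, \<xi>) =
    (bracket0 f g,
     D (kaehler_d R P0 f) \<xi> \<oplus>\<^bsub>P1\<^esub> bracket1 \<eta> \<xi> \<oplus>\<^bsub>P1\<^esub> T_map R P0 P1 D K (f, \<eta>) g)"
  using assms
  by (simp add: bracket_eq T_map_def P1.M.minus_eq P1.M.a_ac D_closed K_closed bracket1_closed
      kaehler_d_closed)

lemma casimirs_trivial_extension_iff:
  assumes k: "k \<in> carrier P0" and \<zeta>: "\<zeta> \<in> carrier P1"
  shows "(k, \<zeta>) \<in> casimirs (trivial_extension P0 P1) bracket \<longleftrightarrow>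
    k \<in> casimirs P0 bracket0 \<and> (k, \<zeta>) \<in> T_kernel R P0 P1 D K \<and>
    (\<forall>\<xi>\<in>carrier P1. D (kaehler_d R P0 k) \<xi> \<oplus>\<^bsub>P1\<^esub> bracket1 \<zeta> \<xi> = \<zero>\<^bsub>P1\<^esub>)"
proof -
  let ?L = "\<lambda>\<xi>. D (kaehler_d R P0 k) \<xi> \<oplus>\<^bsub>P1\<^esub> bracket1 \<zeta> \<xi>"
  let ?T = "T_map R P0 P1 D K (k, \<zeta>)"
  have L_closed: "?L \<xi> \<in> carrier P1" if "\<xi> \<in> carrier P1" for \<xi>
    using that k \<zeta> by (simp add: D_closed bracket1_closed kaehler_d_closed)
  have L0: "?L \<zero>\<^bsub>P1\<^esub> = \<zero>\<^bsub>P1\<^esub>"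
    using k \<zeta> by (simp add: D_zero_right bracket1_zero_right kaehler_d_closed)
  \<comment> \<open>An arbitrary element of the extension is a pair \<open>(g, \<xi>)\<close>, and a
    bracket is zero exactly when both components are. The Casimir condition thus becomes two
    equations in which \<open>g\<close> and \<open>\<xi>\<close> vary independently.\<close>
  have "(k, \<zeta>) \<in> casimirs (trivial_extension P0 P1) bracket \<longleftrightarrow>
      (\<forall>g\<in>carrier P0. \<forall>\<xi>\<in>carrier P1. bracket0 k g = \<zero>\<^bsub>P0\<^esub> \<and> ?L \<xi> \<oplus>\<^bsub>P1\<^esub> ?T g = \<zero>\<^bsub>P1\<^esub>)"
    using k \<zeta> by (auto simp: casimirs_def trivial_extension_def bracket_T_map)
  also have "\<dots> \<longleftrightarrow> (\<forall>g\<in>carrier P0. bracket0 k g = \<zero>\<^bsub>P0\<^esub>) \<and>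
      (\<forall>g\<in>carrier P0. ?T g = \<zero>\<^bsub>P1\<^esub>) \<and> (\<forall>\<xi>\<in>carrier P1. ?L \<xi> = \<zero>\<^bsub>P1\<^esub>)"
    (is "?lhs \<longleftrightarrow> ?rhs")
  proof
    assume h: ?lhs
    have "?T g = \<zero>\<^bsub>P1\<^esub>" if "g \<in> carrier P0" for g
    proof -
      have "?L \<zero>\<^bsub>P1\<^esub> \<oplus>\<^bsub>P1\<^esub> ?T g = \<zero>\<^bsub>P1\<^esub>" using h that by blast
      then show ?thesis using T_map_closed[OF k \<zeta> that] by (simp add: L0)
    qed
    moreover have "?L \<xi> = \<zero>\<^bsub>P1\<^esub>" if "\<xi> \<in> carrier P1" for \<xi>
    proof -
      have "?L \<xi> \<oplus>\<^bsub>P1\<^esub> ?T \<zero>\<^bsub>P0\<^esub> = \<zero>\<^bsub>P1\<^esub>" using h that by simp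
      then show ?thesis using L_closed[OF that] by (simp add: T_map_zero[OF k \<zeta>])
    qed
    \<comment> \<open>The equation for \<open>bracket0\<close> does not mention
      \<open>\<xi>\<close>; it can be extracted from the double quantifier because
      \<open>carrier P1\<close> is nonempty.\<close>
    ultimately show ?rhs using h by blast
  qed simp
  finally show ?thesis using k \<zeta> by (auto simp: casimirs_def T_kernel_def trivial_extension_def)
qed

end

theorem proposition7p4:
  fixes R :: "('r, 'x) ring_scheme"
    and P0 :: "('r, 'a, 'y) module_scheme"
    and P1 :: "('a, 'b, 'z) module_scheme"
    and bracket0 :: "'a \<Rightarrow> 'a \<Rightarrow> 'a"
    and bracket :: "'a \<times> 'b \<Rightarrow> 'a \<times> 'b \<Rightarrow> 'a \<times> 'b"
    and bracket1 :: "'b \<Rightarrow> 'b \<Rightarrow> 'b"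
    and D :: "('a \<Rightarrow> 'a) set \<Rightarrow> 'b \<Rightarrow> 'b"
    and K :: "('a \<Rightarrow> 'a) set \<Rightarrow> ('a \<Rightarrow> 'a) set \<Rightarrow> 'b"
  assumes admissible: "admissible_poisson_algebra R P0 bracket0 P1 bracket"
    and triple: "corresponding_poisson_triple R P0 bracket0 P1 bracket bracket1 D K"
    and elem: "(k, \<zeta>) \<in> carrier (trivial_extension P0 P1)"
  shows "(k, \<zeta>) \<in> casimirs (trivial_extension P0 P1) bracket \<longleftrightarrow>
    (k, \<zeta>) \<in> (casimirs P0 bracket0 \<times> carrier P1) \<inter> T_kernel R P0 P1 D K \<and>
    (\<forall>\<xi>\<in>carrier P1. D (kaehler_d R P0 k) \<xi> \<oplus>\<^bsub>P1\<^esub> bracket1 \<zeta> \<xi> = \<zero>\<^bsub>P1\<^esub>)"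
proof -
  interpret corresponding_poisson_triple R P0 bracket0 P1 bracket bracket1 D K by (rule triple)
  \<comment> \<open>With \<open>\<zeta>\<close> known to lie in \<open>carrier P1\<close>,
    membership in the product \<open>casimirs P0 bracket0 \<times> carrier P1\<close> says just that
    \<open>k\<close> is a Casimir element of \<open>P0\<close>.\<close>
  have "k \<in> carrier P0" "\<zeta> \<in> carrier P1" using elem by (auto simp: trivial_extension_def)
  then show ?thesis by (simp add: casimirs_trivial_extension_iff)
qed

end
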